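(* Let $\eta>0$ and let $\mathcal{P}_0\subset\mathbb{R}^2$ be a nonempty bounded convex polytope with $b\neq0$ for all $[a,b]^T\in\mathcal{P}_0$ (no assumption $\lambda(\mathcal{P}_0)<1$ is made). Fix constants $\lambda^*,p>0$ satisfying $\lambda^*>\frac1p$. Consider the system $x_{n+1}=ax_n+bu_n+w_n$ with unknown constant parameters $[a,b]^T\in\mathcal{P}_0$ and disturbances $|w_n|\le\eta$, under the time-varying state feedback $$u_n=u^{PAL}_n(x_n)=k_nx_n,\qquad k_n=(-1)^n\frac{k_{max}(\mathcal{P}_n)}{\lambda^*p-1}.$$ Then for every $n\ge2$ satisfying $\min\{|x_{n-1}|,|x_{n-2}|\}\ge p\eta$, one has $\lambda(\mathcal{P}_n)\le\lambda^*$.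
   Context: For a nonempty bounded convex polytope $\mathcal{P}\subset\mathbb{R}^2$ of parameters $[a,b]^T$ with $b\ne0$ on $\mathcal{P}$, the stability margin is $\lambda(\mathcal{P}):=\min_{k\in\mathbb{R}}\max_{[a,b]^T\in\mathcal{P}}|a+bk|$ and the maximum deadbeat gain is $k_{max}(\mathcal{P}):=\max_{[a,b]^T\in\mathcal{P}}\left|-\frac ab\right|$. Consistent sets: $\mathcal{S}(x_{n:n+1},u_n):=\{[a,b]^T\in\mathbb{R}^2 : |x_{n+1}-ax_n-bu_n|\le\eta\}$. The remaining uncertainty sets along a trajectory are defined recursively by $\mathcal{P}_{n+1}=\mathcal{P}_n\cap\mathcal{S}(x_{n:n+1},u_n)$, starting from the given $\mathcal{P}_0$. *)

theory Defs
  imports "HOL-Analysis.Analysis"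
begin

text \<open>
  A parameter vector \<open>[a, b]\<^sup>T\<close> is the pair \<open>(a, b)\<close> in the Euclidean space \<open>real \<times> real\<close>.
  Minima and maxima over the reals are written \<open>INF\<close> and \<open>SUP\<close>; the attainment lemmas below
  show that on nonempty compact sets (such as polytopes) avoiding \<open>b = 0\<close> these are genuine minima and maxima.
\<close>

definition stability_margin :: "(real \<times> real) set \<Rightarrow> real" where
  "stability_margin P = (INF k. SUP (a, b)\<in>P. \<bar>a + b * k\<bar>)"

definition max_deadbeat_gain :: "(real \<times> real) set \<Rightarrow> real" where
  "max_deadbeat_gain P = (SUP (a, b)\<in>P. \<bar>- (a / b)\<bar>)"

definition consistent_set :: "real \<Rightarrow> real \<Rightarrow> real \<Rightarrow> real \<Rightarrow> (real \<times> real) set" where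
  "consistent_set \<eta> x x' u = {(a, b). \<bar>x' - a * x - b * u\<bar> \<le> \<eta>}"

primrec uncertainty_set ::
  "real \<Rightarrow> (real \<times> real) set \<Rightarrow> (nat \<Rightarrow> real) \<Rightarrow> (nat \<Rightarrow> real) \<Rightarrow> nat \<Rightarrow> (real \<times> real) set" where
  "uncertainty_set \<eta> P\<^sub>0 x u 0 = P\<^sub>0"
| "uncertainty_set \<eta> P\<^sub>0 x u (Suc n) =
     uncertainty_set \<eta> P\<^sub>0 x u n \<inter> consistent_set \<eta> (x n) (x (Suc n)) (u n)"

lemma compact_SUP_attained:
  fixes f :: "'a::topological_space \<Rightarrow> real"
  assumes "compact P" "P \<noteq> {}" "continuous_on P f"
  shows "\<exists>v\<in>P. f v = (SUP w\<in>P. f w) \<and> (\<forall>w\<in>P. f w \<le> f v)"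
proof -
  obtain v where v: "v \<in> P" "\<forall>w\<in>P. f w \<le> f v"
    using continuous_attains_sup[OF assms] by blast
  then have "(SUP w\<in>P. f w) = f v"
    by (intro cSup_eq_maximum) auto
  with v show ?thesis by (intro bexI[of _ v]) simp_all
qed

lemma worst_case_attained:
  fixes P :: "(real \<times> real) set"
  assumes "compact P" "P \<noteq> {}"
  shows "\<exists>(a, b)\<in>P. \<bar>a + b * k\<bar> = (SUP (a, b)\<in>P. \<bar>a + b * k\<bar>) \<and>
           (\<forall>(a', b')\<in>P. \<bar>a' + b' * k\<bar> \<le> \<bar>a + b * k\<bar>)"
proof -
  have "continuous_on P (\<lambda>v. \<bar>fst v + snd v * k\<bar>)"
    by (intro continuous_intros)
  from compact_SUP_attained[OF assms(1,2) this]
  show ?thesis by (simp add: case_prod_beta)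
qed

lemma max_deadbeat_gain_attained:
  assumes "compact P" "P \<noteq> {}" "\<forall>(a, b)\<in>P. b \<noteq> 0"
  shows "\<exists>(a, b)\<in>P. \<bar>- (a / b)\<bar> = max_deadbeat_gain P \<and>
           (\<forall>(a', b')\<in>P. \<bar>- (a' / b')\<bar> \<le> \<bar>- (a / b)\<bar>)"
proof -
  have "continuous_on P (\<lambda>v. \<bar>- (fst v / snd v)\<bar>)"
    using assms(3) by (intro continuous_intros) auto
  from compact_SUP_attained[OF assms(1,2) this]
  show ?thesis by (simp add: case_prod_beta max_deadbeat_gain_def)
qed

lemma stability_margin_attained:
  assumes P: "compact P" "P \<noteq> {}" "\<forall>(a, b)\<in>P. b \<noteq> 0"
  shows "\<exists>k. stability_margin P = (SUP (a, b)\<in>P. \<bar>a + b * k\<bar>) \<and>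
           (\<forall>k'. stability_margin P \<le> (SUP (a, b)\<in>P. \<bar>a + b * k'\<bar>))"
proof -
  define g where "g = (\<lambda>k. SUP (a, b)\<in>P. \<bar>a + b * k\<bar>)"
  have ub: "\<bar>a + b * k\<bar> \<le> g k" if "(a, b) \<in> P" for a b k
  proof -
    from worst_case_attained[OF P(1,2), of k]
    obtain v where v: "v \<in> P" "\<bar>fst v + snd v * k\<bar> = g k"
      "\<forall>v'\<in>P. \<bar>fst v' + snd v' * k\<bar> \<le> \<bar>fst v + snd v * k\<bar>"
      unfolding g_def case_prod_beta by blast
    from bspec[OF v(3) that] v(2) show ?thesis by simp
  qed
  obtain B where B: "\<And>v. v \<in> P \<Longrightarrow> norm v \<le> B"
    using compact_imp_bounded[OF P(1)] by (auto simp: bounded_iff)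
  have le: "g k \<le> g k' + B * \<bar>k - k'\<bar>" for k k'
  proof -
    obtain a b where ab: "(a, b) \<in> P" "\<bar>a + b * k\<bar> = g k"
      using worst_case_attained[OF P(1,2), of k] by (auto simp: g_def)
    have "\<bar>b\<bar> \<le> B" using norm_snd_le[of b a] B[OF ab(1)] by simp
    then have "\<bar>b * (k - k')\<bar> \<le> B * \<bar>k - k'\<bar>"
      by (simp add: abs_mult mult_right_mono)
    moreover have "a + b * k = (a + b * k') + b * (k - k')" by (simp add: algebra_simps)
    ultimately show ?thesis using ub[OF ab(1), of k'] ab(2) by linarith
  qed
  have "dist (g k) (g k') \<le> B * dist k k'" for k k'
    using le[of k k'] le[of k' k] by (simp add: dist_real_def abs_minus_commute abs_le_iff)
  moreover have "0 \<le> B" using B P(2) order_trans[OF norm_ge_zero] by blast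
  ultimately have "B-lipschitz_on UNIV g" by (intro lipschitz_onI) auto
  then have cont: "continuous_on UNIV g" by (rule lipschitz_on_continuous_on)
  obtain a b where ab: "(a, b) \<in> P" "b \<noteq> 0" using P(2,3) by fastforce
  define R where "R = (\<bar>a\<bar> + g 0) / \<bar>b\<bar>"
  have "0 \<le> g 0" using ub[OF ab(1), of 0] by simp
  then have R: "0 \<le> R" by (simp add: R_def)
  have "compact {-R..R}" "{-R..R} \<noteq> {}" "continuous_on {-R..R} g"
    using R continuous_on_subset[OF cont] by auto
  from continuous_attains_inf[OF this]
  obtain k where k: "\<And>k'. k' \<in> {-R..R} \<Longrightarrow> g k \<le> g k'" by blast
  have min: "g k \<le> g k'" for k'
  proof (cases "k' \<in> {-R..R}")
    case False
    then have "R \<le> \<bar>k'\<bar>" by auto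
    then have "\<bar>a\<bar> + g 0 \<le> \<bar>b * k'\<bar>"
      using ab(2) by (simp add: R_def abs_mult field_simps)
    then have "g 0 \<le> \<bar>a + b * k'\<bar>" by linarith
    then show ?thesis using ub[OF ab(1), of k'] k[of 0] R by simp
  qed (rule k)
  then have "stability_margin P = g k"
    unfolding stability_margin_def g_def[symmetric]
    by (intro cInf_eq_minimum) auto
  with min show ?thesis by (auto simp: g_def)
qed

end

theory Submission imports Defs begin

text \<open>
  Put \<open>d = lam * p - 1 > 0\<close>. A measurement taken at a state with \<open>\<bar>x\<bar> \<ge> p \<eta>\<close> under feedback gain \<open>\<kappa>\<close>
  confines the closed-loop value \<open>a + b \<kappa>\<close> to an interval of length \<open>2 / p\<close>, so any two surviving
  parameters have differences \<open>\<Delta>a\<close>, \<open>\<Delta>b\<close> with \<open>\<bar>\<Delta>a + \<Delta>b \<kappa>\<bar> \<le> 2 / p\<close>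
  (\<open>closed_loop_difference_bound\<close>). The alternating sign of the
  feedback supplies two consecutive such bounds with gains of opposite sign. Since the uncertainty
  sets shrink, so do their deadbeat gains, and both feedback gains have modulus at least \<open>c / d\<close>, where
  \<open>c\<close> is the deadbeat gain of the current set. Hence \<open>\<bar>\<Delta>a\<bar> + (c / d) \<bar>\<Delta>b\<bar> \<le> 2 / p\<close>
  (\<open>opposite_gains_bound\<close>).

  On the other side, \<open>b\<close> has a constant sign on the convex set \<open>P\<^sub>0\<close>, so the parameter \<open>(a, b)\<close> admits
  exactly an interval of gains achieving \<open>\<bar>a + b k\<bar> \<le> lam\<close>. Helly's theorem on the line reduces the
  existence of a common gain to a condition on pairs,
  \<open>a\<^sub>2 \<bar>b\<^sub>1\<bar> - a\<^sub>1 \<bar>b\<^sub>2\<bar> \<le> lam (\<bar>b\<^sub>1\<bar> + \<bar>b\<^sub>2\<bar>)\<close> (\<open>common_gain_from_pairs\<close>). The left side is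
  half of \<open>(a\<^sub>1 + a\<^sub>2) \<Delta>\<bar>b\<bar> - \<Delta>a (\<bar>b\<^sub>1\<bar> + \<bar>b\<^sub>2\<bar>)\<close>; as \<open>\<bar>a\<^sub>i\<bar> \<le> c \<bar>b\<^sub>i\<bar>\<close>, it is at most
  \<open>(c \<bar>\<Delta>b\<bar> + \<bar>\<Delta>a\<bar>) / 2\<close> times \<open>\<bar>b\<^sub>1\<bar> + \<bar>b\<^sub>2\<bar>\<close>, and the difference bound makes this factor at most
  \<open>(d + 1) / p = lam\<close>.
\<close>

section \<open>Uncertainty sets and deadbeat gains\<close>

lemma closed_consistent_set: "closed (consistent_set \<eta> x x' u)"
proof -
  have "consistent_set \<eta> x x' u = {v. \<bar>x' - fst v * x - snd v * u\<bar> \<le> \<eta>}"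
    by (auto simp: consistent_set_def)
  then show ?thesis
    by (auto intro!: closed_Collect_le continuous_intros)
qed

lemma uncertainty_set_antimono:
  assumes "m \<le> n"
  shows "uncertainty_set \<eta> Q x u n \<subseteq> uncertainty_set \<eta> Q x u m"
  using assms by (induction rule: dec_induct) auto

lemma compact_uncertainty_set:
  assumes "compact Q"
  shows "compact (uncertainty_set \<eta> Q x u n)"
  using assms by (induction n) (auto intro: compact_Int_closed closed_consistent_set)

lemma true_parameter_in_uncertainty_set:
  assumes "(a, b) \<in> Q" "\<And>n. \<bar>w n\<bar> \<le> \<eta>" "\<And>n. x (Suc n) = a * x n + b * u n + w n"
  shows "(a, b) \<in> uncertainty_set \<eta> Q x u n"
  by (induction n) (use assms in \<open>auto simp: consistent_set_def\<close>)

lemma abs_le_max_deadbeat_gain: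
  assumes "compact Q" "\<forall>(a, b)\<in>Q. b \<noteq> 0" "(a, b) \<in> Q"
  shows "\<bar>a\<bar> \<le> max_deadbeat_gain Q * \<bar>b\<bar>"
proof -
  have "Q \<noteq> {}" and "b \<noteq> 0" using assms by auto
  then have "\<bar>- (a / b)\<bar> \<le> max_deadbeat_gain Q"
    using max_deadbeat_gain_attained[of Q] assms by fastforce
  then show ?thesis using \<open>b \<noteq> 0\<close> by (simp add: field_simps)
qed

lemma max_deadbeat_gain_nonneg:
  assumes "compact Q" "Q \<noteq> {}" "\<forall>(a, b)\<in>Q. b \<noteq> 0"
  shows "max_deadbeat_gain Q \<ge> 0"
proof -
  obtain a b where "\<bar>- (a / b)\<bar> = max_deadbeat_gain Q"
    using max_deadbeat_gain_attained[OF assms] by blast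
  then show ?thesis by (metis abs_ge_zero)
qed

lemma max_deadbeat_gain_mono:
  assumes "compact Q" "compact R" "R \<noteq> {}" "R \<subseteq> Q" "\<forall>(a, b)\<in>Q. b \<noteq> 0"
  shows "max_deadbeat_gain R \<le> max_deadbeat_gain Q"
proof -
  have "\<forall>(a, b)\<in>R. b \<noteq> 0" using assms by auto
  then obtain a b where ab: "(a, b) \<in> R" "\<bar>- (a / b)\<bar> = max_deadbeat_gain R"
    using max_deadbeat_gain_attained[of R] assms by auto
  then have "(a, b) \<in> Q" "b \<noteq> 0" using assms by auto
  then have "\<bar>a / b\<bar> \<le> max_deadbeat_gain Q"
    using abs_le_max_deadbeat_gain[of Q a b] assms by (simp add: field_simps)
  then show ?thesis using ab by simp
qed

section \<open>A common gain for all parameters\<close>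

text \<open>A convex set cannot cross the line \<open>b = 0\<close> without meeting it.\<close>

lemma convex_constant_sign:
  fixes Q :: "(real \<times> real) set"
  assumes "convex Q" "\<forall>(a, b)\<in>Q. b \<noteq> 0"
  obtains s :: real where "\<bar>s\<bar> = 1" "\<And>a b. (a, b) \<in> Q \<Longrightarrow> b = s * \<bar>b\<bar>"
proof -
  have conv: "convex (snd ` Q)"
    using assms(1) by (rule convex_linear_image[OF linear_snd])
  have nz: "0 \<notin> snd ` Q" using assms(2) by auto
  have "(\<forall>b\<in>snd ` Q. b > 0) \<or> (\<forall>b\<in>snd ` Q. b < 0)"
  proof (rule ccontr)
    assume "\<not> ?thesis"
    then obtain b c where "b \<in> snd ` Q" "c \<in> snd ` Q" "b \<le> 0" "0 \<le> c"
      by (meson not_less)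
    then show False
      using conv nz by (meson is_interval_convex_1 mem_is_interval_1_I)
  qed
  then show thesis
  proof
    assume "\<forall>b\<in>snd ` Q. b > 0"
    then show thesis by (intro that[of 1]) force+
  next
    assume "\<forall>b\<in>snd ` Q. b < 0"
    then show thesis by (intro that[of "-1"]) force+
  qed
qed

text \<open>
  Helly's theorem on the line: the gain \<open>s * K\<close> is admissible for \<open>(a, b)\<close> iff \<open>K\<close> lies in the interval
  with endpoints \<open>(- l - a) / \<bar>b\<bar>\<close> and \<open>(l - a) / \<bar>b\<bar>\<close>. The hypothesis on pairs says that every lower
  endpoint is below every upper one, and then the supremum of the lower endpoints works.
\<close>

lemma common_gain_from_pairs:
  fixes Q :: "(real \<times> real) set" and l s :: real
  assumes "Q \<noteq> {}" "\<forall>(a, b)\<in>Q. b \<noteq> 0"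
    and s: "\<bar>s\<bar> = 1" "\<And>a b. (a, b) \<in> Q \<Longrightarrow> b = s * \<bar>b\<bar>"
    and pairs: "\<And>a1 b1 a2 b2. (a1, b1) \<in> Q \<Longrightarrow> (a2, b2) \<in> Q \<Longrightarrow>
      a2 * \<bar>b1\<bar> - a1 * \<bar>b2\<bar> \<le> l * (\<bar>b1\<bar> + \<bar>b2\<bar>)"
  obtains k where "\<And>a b. (a, b) \<in> Q \<Longrightarrow> \<bar>a + b * k\<bar> \<le> l"
proof -
  define L where "L = (\<lambda>(a, b). (- l - a) / \<bar>b\<bar>) ` Q"
  define K where "K = Sup L"
  have nz: "b \<noteq> 0" if "(a, b) \<in> Q" for a b using assms(2) that by auto
  have ub: "y \<le> (l - a) / \<bar>b\<bar>" if ab: "(a, b) \<in> Q" and "y \<in> L" for y a b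
  proof -
    obtain a' b' where ab': "(a', b') \<in> Q" "y = (- l - a') / \<bar>b'\<bar>"
      using \<open>y \<in> L\<close> by (auto simp: L_def)
    have "\<bar>b\<bar> > 0" "\<bar>b'\<bar> > 0" using nz ab ab' by auto
    with pairs[OF ab'(1) ab] show ?thesis
      unfolding ab'(2) by (simp add: field_simps)
  qed
  have "L \<noteq> {}" using \<open>Q \<noteq> {}\<close> by (simp add: L_def)
  have "\<bar>a + b * (s * K)\<bar> \<le> l" if ab: "(a, b) \<in> Q" for a b
  proof -
    have pos: "\<bar>b\<bar> > 0" using nz ab by auto
    have "K \<le> (l - a) / \<bar>b\<bar>"
      unfolding K_def using \<open>L \<noteq> {}\<close> ub[OF ab] by (rule cSup_least)
    moreover have "(- l - a) / \<bar>b\<bar> \<le> K"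
      unfolding K_def
    proof (rule cSup_upper)
      show "(- l - a) / \<bar>b\<bar> \<in> L" using ab unfolding L_def by (rule rev_image_eqI) simp
      show "bdd_above L" using ub[OF ab] by (auto simp: bdd_above_def)
    qed
    ultimately have "\<bar>a + \<bar>b\<bar> * K\<bar> \<le> l"
      using pos by (simp add: field_simps abs_le_iff)
    moreover have "b * s = \<bar>b\<bar>"
    proof -
      have "s * s = 1" using s(1) by (metis abs_mult_self mult_1)
      then show ?thesis using s(2)[OF ab] by (metis mult.assoc mult.commute mult_1)
    qed
    ultimately show ?thesis by (simp flip: mult.assoc)
  qed
  then show thesis by (rule that)
qed

section \<open>Information from two consecutive measurements\<close>

lemma closed_loop_difference_bound:
  fixes \<eta> p x x' k :: real
  assumes "\<eta> > 0" "p > 0" "\<bar>x\<bar> \<ge> p * \<eta>"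
    and "(a1, b1) \<in> consistent_set \<eta> x x' (k * x)"
    and "(a2, b2) \<in> consistent_set \<eta> x x' (k * x)"
  shows "\<bar>(a1 - a2) + (b1 - b2) * k\<bar> \<le> 2 / p"
proof -
  let ?D = "(a1 - a2) + (b1 - b2) * k"
  have "\<bar>?D\<bar> * (p * \<eta>) \<le> \<bar>?D\<bar> * \<bar>x\<bar>"
    using assms(3) by (simp add: mult_left_mono)
  also have "\<dots> = \<bar>(x' - a2 * x - b2 * (k * x)) - (x' - a1 * x - b1 * (k * x))\<bar>"
    by (simp add: algebra_simps flip: abs_mult)
  also have "\<dots> \<le> 2 * \<eta>"
    using assms(4,5) unfolding consistent_set_def by auto
  finally show ?thesis using assms(1,2) by (simp add: field_simps)
qed

text \<open>
  The function \<open>\<kappa> \<mapsto> A + B \<kappa>\<close> is monotone, so a bound on it at a gain above \<open>t\<close> and at a gain below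
  \<open>- t\<close> carries over to \<open>t\<close> and \<open>- t\<close>; and \<open>\<bar>A\<bar> + t \<bar>B\<bar>\<close> is the larger of \<open>\<bar>A + B t\<bar>\<close> and \<open>\<bar>A - B t\<bar>\<close>.
\<close>

lemma opposite_gains_bound:
  fixes A B t r k1 k2 :: real
  assumes "t \<ge> 0" "k1 \<ge> t" "k2 \<le> - t" "\<bar>A + B * k1\<bar> \<le> r" "\<bar>A + B * k2\<bar> \<le> r"
  shows "\<bar>A\<bar> + t * \<bar>B\<bar> \<le> r"
proof (cases "B \<ge> 0")
  case True
  have "B * t \<le> B * k1" "B * k2 \<le> B * (- t)"
    using assms True by (simp_all only: mult_left_mono)
  moreover have "t * \<bar>B\<bar> = B * t" using True by simp
  ultimately show ?thesis using assms(4,5) by linarith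
next
  case False
  have "B * k1 \<le> B * t" "B * (- t) \<le> B * k2"
    using assms False by (simp_all only: mult_left_mono_neg not_le less_imp_le)
  moreover have "t * \<bar>B\<bar> = - (B * t)" using False by simp
  ultimately show ?thesis using assms(4,5) by linarith
qed

lemma pair_condition:
  fixes a1 a2 b1 b2 c d p :: real
  assumes "c \<ge> 0" "d > 0" "p > 0"
    and a: "\<bar>a1\<bar> \<le> c * \<bar>b1\<bar>" "\<bar>a2\<bar> \<le> c * \<bar>b2\<bar>"
    and diff: "\<bar>a1 - a2\<bar> + c / d * \<bar>b1 - b2\<bar> \<le> 2 / p"
  shows "a2 * \<bar>b1\<bar> - a1 * \<bar>b2\<bar> \<le> (d + 1) / p * (\<bar>b1\<bar> + \<bar>b2\<bar>)"
proof -
  let ?s = "\<bar>b1\<bar> + \<bar>b2\<bar>"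
  have "c / d * \<bar>b1 - b2\<bar> \<le> 2 / p" using diff by linarith
  then have "c * \<bar>b1 - b2\<bar> \<le> d * (2 / p)"
    using \<open>d > 0\<close> by (simp add: field_simps)
  moreover have "0 \<le> c / d * \<bar>b1 - b2\<bar>" using assms by simp
  then have "\<bar>a1 - a2\<bar> \<le> 2 / p" using diff by linarith
  ultimately have sum: "c * \<bar>b1 - b2\<bar> + \<bar>a1 - a2\<bar> \<le> 2 * ((d + 1) / p)"
    using \<open>p > 0\<close> by (simp add: field_simps)
  have "(a1 + a2) * (\<bar>b1\<bar> - \<bar>b2\<bar>) \<le> \<bar>a1 + a2\<bar> * \<bar>\<bar>b1\<bar> - \<bar>b2\<bar>\<bar>"
    by (metis abs_ge_self abs_mult)
  also have "\<dots> \<le> (c * ?s) * \<bar>b1 - b2\<bar>"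
  proof (rule mult_mono)
    show "\<bar>a1 + a2\<bar> \<le> c * ?s"
      using a abs_triangle_ineq[of a1 a2] unfolding distrib_left by linarith
  qed (use \<open>c \<ge> 0\<close> in auto)
  finally have 1: "(a1 + a2) * (\<bar>b1\<bar> - \<bar>b2\<bar>) \<le> (c * ?s) * \<bar>b1 - b2\<bar>" .
  have 2: "- (a1 - a2) * ?s \<le> \<bar>a1 - a2\<bar> * ?s"
    by (intro mult_right_mono) auto
  have "2 * (a2 * \<bar>b1\<bar> - a1 * \<bar>b2\<bar>) = (a1 + a2) * (\<bar>b1\<bar> - \<bar>b2\<bar>) + - (a1 - a2) * ?s"
    by (simp add: algebra_simps)
  also have "\<dots> \<le> (c * \<bar>b1 - b2\<bar> + \<bar>a1 - a2\<bar>) * ?s"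
    using add_mono[OF 1 2] by (simp add: algebra_simps)
  also have "\<dots> \<le> 2 * ((d + 1) / p) * ?s"
    using sum by (intro mult_right_mono) auto
  finally show ?thesis by (simp only: mult.assoc mult_le_cancel_left_pos zero_less_numeral)
qed

section \<open>The stability margin after two large states\<close>

lemma stability_margin_le:
  assumes "compact Q" "Q \<noteq> {}" "\<forall>(a, b)\<in>Q. b \<noteq> 0"
    and "\<And>a b. (a, b) \<in> Q \<Longrightarrow> \<bar>a + b * k\<bar> \<le> l"
  shows "stability_margin Q \<le> l"
proof -
  have "stability_margin Q \<le> (SUP (a, b)\<in>Q. \<bar>a + b * k\<bar>)"
    using stability_margin_attained[OF assms(1-3)] by blast
  also have "\<dots> \<le> l" using assms(2,4) by (intro cSUP_least) auto
  finally show ?thesis .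
qed

theorem theoremV3:
  fixes \<eta> lam p a b :: real
    and P\<^sub>0 :: "(real \<times> real) set"
    and x u w k :: "nat \<Rightarrow> real"
    and P :: "nat \<Rightarrow> (real \<times> real) set"
  assumes "\<eta> > 0"
    and "polytope P\<^sub>0" and "P\<^sub>0 \<noteq> {}" and "\<forall>(a', b')\<in>P\<^sub>0. b' \<noteq> 0"
    and "lam > 0" and "p > 0" and "lam > 1 / p"
    and "(a, b) \<in> P\<^sub>0"
    and "\<forall>n. \<bar>w n\<bar> \<le> \<eta>"
    and "\<forall>n. x (Suc n) = a * x n + b * u n + w n"
    and "\<forall>n. P n = uncertainty_set \<eta> P\<^sub>0 x u n"
    and "\<forall>n. k n = (- 1) ^ n * (max_deadbeat_gain (P n) / (lam * p - 1))"
    and "\<forall>n. u n = k n * x n"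
  shows "\<forall>n\<ge>2. min \<bar>x (n - 1)\<bar> \<bar>x (n - 2)\<bar> \<ge> p * \<eta> \<longrightarrow> stability_margin (P n) \<le> lam"
proof (intro allI impI)
  fix n :: nat
  assume "n \<ge> 2" and large: "min \<bar>x (n - 1)\<bar> \<bar>x (n - 2)\<bar> \<ge> p * \<eta>"
  then obtain m where n: "n = Suc (Suc m)"
    by (metis add_2_eq_Suc le_Suc_ex)
  define d where "d = lam * p - 1"
  have "d > 0" using \<open>lam > 1 / p\<close> \<open>p > 0\<close> by (simp add: d_def field_simps)
  have lam: "lam = (d + 1) / p" using \<open>p > 0\<close> by (simp add: d_def)
  note P_def = assms(11)[rule_format]
  have sub0: "P i \<subseteq> P\<^sub>0" for i
    using uncertainty_set_antimono[of 0 i \<eta> P\<^sub>0 x u] by (simp add: P_def)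
  have nz: "\<forall>(a, b)\<in>P i. b \<noteq> 0" for i using sub0 assms(4) by blast
  have comp: "compact (P i)" for i
    unfolding P_def using \<open>polytope P\<^sub>0\<close> by (intro compact_uncertainty_set polytope_imp_compact)
  have "(a, b) \<in> P i" for i
    unfolding P_def using assms(8-10) by (intro true_parameter_in_uncertainty_set) auto
  then have ne: "P i \<noteq> {}" for i by blast
  define c where "c = max_deadbeat_gain (P n)"
  have "c \<ge> 0" unfolding c_def using comp ne nz by (rule max_deadbeat_gain_nonneg)
  have gain: "c / d \<le> max_deadbeat_gain (P i) / d" if "i \<le> n" for i
  proof -
    have "P n \<subseteq> P i" using uncertainty_set_antimono[OF that] by (simp add: P_def)
    then have "c \<le> max_deadbeat_gain (P i)"
      unfolding c_def by (intro max_deadbeat_gain_mono comp ne nz)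
    then show ?thesis using \<open>d > 0\<close> by (simp add: divide_right_mono)
  qed
  have k: "k i = (- 1) ^ i * (max_deadbeat_gain (P i) / d)" for i
    using assms(12) by (simp add: d_def)
  obtain s where s: "\<bar>s\<bar> = 1" "\<And>a b. (a, b) \<in> P\<^sub>0 \<Longrightarrow> b = s * \<bar>b\<bar>"
    using convex_constant_sign[OF polytope_imp_convex[OF \<open>polytope P\<^sub>0\<close>] assms(4)] by blast
  have pairs: "a2 * \<bar>b1\<bar> - a1 * \<bar>b2\<bar> \<le> lam * (\<bar>b1\<bar> + \<bar>b2\<bar>)"
    if 1: "(a1, b1) \<in> P n" and 2: "(a2, b2) \<in> P n" for a1 b1 a2 b2
  proof -
    let ?A = "a1 - a2" and ?B = "b1 - b2"
    have bound: "\<bar>?A + ?B * k i\<bar> \<le> 2 / p" if "i = m \<or> i = Suc m" for i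
    proof (rule closed_loop_difference_bound)
      show "\<bar>x i\<bar> \<ge> p * \<eta>" using large that n by auto
      have "P n \<subseteq> consistent_set \<eta> (x i) (x (Suc i)) (k i * x i)"
        using that assms(13) by (auto simp: P_def n)
      then show "(a1, b1) \<in> consistent_set \<eta> (x i) (x (Suc i)) (k i * x i)"
        and "(a2, b2) \<in> consistent_set \<eta> (x i) (x (Suc i)) (k i * x i)"
        using 1 2 by auto
    qed (use assms in auto)
    have t: "c / d \<ge> 0" using \<open>c \<ge> 0\<close> \<open>d > 0\<close> by simp
    have gains: "c / d \<le> max_deadbeat_gain (P m) / d" "c / d \<le> max_deadbeat_gain (P (Suc m)) / d"
      using gain n by auto
    have "\<bar>?A\<bar> + c / d * \<bar>?B\<bar> \<le> 2 / p"
    proof (cases "even m")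
      case True
      show ?thesis
        by (rule opposite_gains_bound[OF t, of "k m" "k (Suc m)", OF _ _ bound bound])
          (use gains True in \<open>simp_all add: k\<close>)
    next
      case False
      show ?thesis
        by (rule opposite_gains_bound[OF t, of "k (Suc m)" "k m", OF _ _ bound bound])
          (use gains False in \<open>simp_all add: k\<close>)
    qed
    moreover have "\<bar>a1\<bar> \<le> c * \<bar>b1\<bar>" "\<bar>a2\<bar> \<le> c * \<bar>b2\<bar>"
      unfolding c_def using abs_le_max_deadbeat_gain[OF comp nz] 1 2 by blast+
    ultimately show ?thesis
      unfolding lam using \<open>c \<ge> 0\<close> \<open>d > 0\<close> \<open>p > 0\<close> by (intro pair_condition)
  qed
  have sP: "b = s * \<bar>b\<bar>" if "(a, b) \<in> P n" for a b using s(2) sub0 that by blast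
  obtain k' where "\<And>a b. (a, b) \<in> P n \<Longrightarrow> \<bar>a + b * k'\<bar> \<le> lam"
    using common_gain_from_pairs[of "P n" s lam] ne nz s(1) sP pairs by blast
  then show "stability_margin (P n) \<le> lam"
    by (rule stability_margin_le[OF comp ne nz])
qed

end
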